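(* Let $G$ and $H$ be graphs of orders $m\ge 2$ and $n\ge 2$, respectively, and let $G+H$ denote their join. Suppose that $\gamma_{ds}(G+H)\ne 2$. Then $\gamma_{ds}(G+H)=3$ if and only if at least one of the following conditions holds: (1) $\gamma_{ds}(G)=3$ or $\gamma_{ds}(H)=3$; (2) $\Delta(G)\ge m-2$ or $\Delta(H)\ge n-2$.
   Context: All graphs are finite, simple and undirected; $\Delta(G)$ denotes the maximum degree of $G$, and the order of a graph is its number of vertices. A set $S\subseteq V(G)$ is a dual-server dominating set (DS-dominating set) of a graph $G$ if there is a partition $\{R,B\}$ of $S$ such that every vertex of $V(G)\setminus S$ has at least one neighbour in $R$ and at least one neighbour in $B$. The dual-server domination number $\gamma_{ds}(G)$ is the minimum cardinality of a DS-dominating set of $G$. The join $G+H$ is the graph obtained from the disjoint union $G\cup H$ by adding all edges joining every vertex of $G$ to every vertex of $H$. *)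

theory Defs
  imports "Graph_Theory.Pair_Digraph"
begin

text \<open>
  A finite simple undirected graph is a \<open>pair_graph\<close>: a finite, loop-free, symmetric digraph whose
  arcs are pairs. An undirected edge is a pair of opposite arcs, so the degree of a vertex is its
  out-degree.
\<close>

definition max_degree :: "'a pair_pre_digraph \<Rightarrow> nat" where
  "max_degree G = Max (out_degree (with_proj G) ` pverts G)"

text \<open>
  The two parts of a partition are nonempty, as usual. Allowing empty parts would make no difference
  to DS-dominating sets of graphs with at least two vertices: if \<open>S\<close> is not the whole vertex set,
  then \<open>R\<close> and \<open>B\<close> are nonempty anyway, and otherwise any partition of \<open>S\<close> will do.
\<close>

definition ds_dominating :: "'a pair_pre_digraph \<Rightarrow> 'a set \<Rightarrow> bool" where
  "ds_dominating G S \<longleftrightarrow>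
     S \<subseteq> pverts G \<and>
     (\<exists>R B. R \<noteq> {} \<and> B \<noteq> {} \<and> R \<inter> B = {} \<and> R \<union> B = S \<and>
       (\<forall>v \<in> pverts G - S. (\<exists>r\<in>R. (v, r) \<in> parcs G) \<and> (\<exists>b\<in>B. (v, b) \<in> parcs G)))"

text \<open>
  On a finite graph with at least two vertices the minimum is taken over a finite nonempty set,
  since the whole vertex set is DS-dominating; on smaller graphs the value is unspecified.
\<close>

definition ds_domination_number :: "'a pair_pre_digraph \<Rightarrow> nat" where
  "ds_domination_number G = Min (card ` {S. ds_dominating G S})"

definition graph_join ::
    "'a pair_pre_digraph \<Rightarrow> 'b pair_pre_digraph \<Rightarrow> ('a + 'b) pair_pre_digraph" where
  "graph_join G H =
     \<lparr> pverts = pverts G <+> pverts H,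
       parcs = {(Inl u, Inl v) | u v. (u, v) \<in> parcs G} \<union>
               {(Inr u, Inr v) | u v. (u, v) \<in> parcs H} \<union>
               {(Inl u, Inr v) | u v. u \<in> pverts G \<and> v \<in> pverts H} \<union>
               {(Inr v, Inl u) | u v. u \<in> pverts G \<and> v \<in> pverts H} \<rparr>"

lemma pair_graph_graph_join:
  assumes "pair_graph G" and "pair_graph H"
  shows "pair_graph (graph_join G H)"
proof -
  interpret G: pair_graph G by fact
  interpret H: pair_graph H by fact
  have wf: "fst e \<in> pverts (graph_join G H) \<and> snd e \<in> pverts (graph_join G H)"
    if "e \<in> parcs (graph_join G H)" for e
    using that by (auto simp: graph_join_def dest: G.wellformed' H.wellformed')
  have fin: "finite (pverts (graph_join G H))"
    by (simp add: graph_join_def G.pair_finite_verts H.pair_finite_verts)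
  have "parcs (graph_join G H) \<subseteq> pverts (graph_join G H) \<times> pverts (graph_join G H)"
    using wf by force
  then have finp: "finite (parcs (graph_join G H))"
    using fin by (meson finite_SigmaI finite_subset)
  have sym: "symmetric (with_proj (graph_join G H))"
    unfolding symmetric_def with_proj_simps
    by (rule symI) (auto simp: graph_join_def dest: G.arcs_symmetric H.arcs_symmetric)
  have noloop: "fst e \<noteq> snd e" if "e \<in> parcs (graph_join G H)" for e
    using that by (auto simp: graph_join_def dest: G.no_loops' H.no_loops')
  show ?thesis
    by unfold_locales (use wf fin finp sym noloop in auto)
qed

lemma ds_dominating_pverts:
  assumes "card (pverts G) \<ge> 2"
  shows "ds_dominating G (pverts G)"
proof -
  obtain x where x: "x \<in> pverts G" using assms by fastforce
  have "pverts G \<noteq> {x}" using assms by auto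
  then have "pverts G - {x} \<noteq> {}" using x by blast
  then show ?thesis
    unfolding ds_dominating_def using x
    by (intro conjI subset_refl exI[of _ "{x}"] exI[of _ "pverts G - {x}"]) auto
qed

end

theory Submission
  imports Defs
begin

text \<open>
  The two colour classes of a dual-server dominating set are nonempty and disjoint, so
  \<open>\<gamma>\<^sub>d\<^sub>s \<ge> 2\<close> always; since \<open>\<gamma>\<^sub>d\<^sub>s (G + H) \<noteq> 2\<close>, the value is \<open>3\<close> exactly when \<open>G + H\<close> has a
  DS-dominating set \<open>S\<close> of size three.

  If \<open>S\<close> lies inside \<open>G\<close>, it DS-dominates \<open>G + H\<close> if and only if it DS-dominates \<open>G\<close>
  (\<open>ds_dominating_join_Inl_iff\<close>); then \<open>\<gamma>\<^sub>d\<^sub>s G = 3\<close>, because a smaller DS-dominating set of \<open>G\<close>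
  would also serve for the join. Otherwise, up to exchanging \<open>G\<close> and \<open>H\<close>, the set \<open>S\<close> consists
  of two vertices \<open>a\<close>, \<open>b\<close> of \<open>G\<close> and one vertex \<open>h\<close> of \<open>H\<close>. One of its colour classes is a
  singleton \<open>{x}\<close>, so every vertex outside \<open>S\<close> is adjacent to \<open>x\<close>
  (\<open>ds_dominating_card_3_common_neighbour\<close>). If \<open>x = h\<close>, then \<open>h\<close> has degree \<open>n - 1\<close> in \<open>H\<close>; if \<open>x\<close>
  is \<open>a\<close> or \<open>b\<close>, then \<open>x\<close> has degree at least \<open>m - 2\<close> in \<open>G\<close>.

  Conversely, a DS-dominating set of \<open>G\<close> of size three serves for the join as well. If
  \<open>\<Delta>(G) \<ge> m - 2\<close>, there are distinct vertices \<open>u\<close> and \<open>w\<close> of \<open>G\<close> such that \<open>u\<close> is adjacent to all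
  vertices of \<open>G\<close> other than \<open>u\<close> and \<open>w\<close> (\<open>max_degree_ge_iff\<close>). Then the classes \<open>{u}\<close> and
  \<open>{w, h}\<close>, with \<open>h\<close> any vertex of \<open>H\<close>, form a DS-dominating set of the join.
\<close>

section \<open>DS-dominating sets and the domination number\<close>

lemma ds_dominatingI:
  assumes "R \<union> B \<subseteq> pverts G" and "R \<noteq> {}" and "B \<noteq> {}" and "R \<inter> B = {}"
    and "\<And>v. v \<in> pverts G - (R \<union> B) \<Longrightarrow> \<exists>r\<in>R. (v, r) \<in> parcs G"
    and "\<And>v. v \<in> pverts G - (R \<union> B) \<Longrightarrow> \<exists>b\<in>B. (v, b) \<in> parcs G"
  shows "ds_dominating G (R \<union> B)"
proof -
  have "\<forall>v \<in> pverts G - (R \<union> B). (\<exists>r\<in>R. (v, r) \<in> parcs G) \<and> (\<exists>b\<in>B. (v, b) \<in> parcs G)"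
    using assms(5,6) by blast
  with assms(1-4) show ?thesis
    unfolding ds_dominating_def by metis
qed

lemma finite_ds_dominating:
  assumes "pair_graph G"
  shows "finite {S. ds_dominating G S}"
proof -
  interpret pair_graph G by fact
  have "{S. ds_dominating G S} \<subseteq> Pow (pverts G)"
    by (auto simp: ds_dominating_def)
  then show ?thesis
    by (rule finite_subset) (simp add: pair_finite_verts)
qed

lemma ds_dominating_card_ge_2:
  assumes "pair_graph G" and "ds_dominating G S"
  shows "card S \<ge> 2"
proof -
  interpret pair_graph G by fact
  obtain R B where RB: "R \<noteq> {}" "B \<noteq> {}" "R \<inter> B = {}" "R \<union> B = S" and "S \<subseteq> pverts G"
    using assms(2) unfolding ds_dominating_def by blast
  then have "finite R" "finite B"
    using pair_finite_verts by (auto intro: finite_subset)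
  then have "card S = card R + card B" "card R \<ge> 1" "card B \<ge> 1"
    using RB by (auto simp: card_Un_disjoint Suc_le_eq card_gt_0_iff)
  then show ?thesis by simp
qed

lemma ds_domination_number_le:
  assumes "pair_graph G" and "ds_dominating G S"
  shows "ds_domination_number G \<le> card S"
  unfolding ds_domination_number_def
  using finite_ds_dominating[OF assms(1)] assms(2) by (intro Min_le) auto

lemma ds_domination_number_attained:
  assumes "pair_graph G" and "card (pverts G) \<ge> 2"
  obtains S where "ds_dominating G S" and "card S = ds_domination_number G"
proof -
  have "{S. ds_dominating G S} \<noteq> {}"
    using ds_dominating_pverts[OF assms(2)] by blast
  then have "ds_domination_number G \<in> card ` {S. ds_dominating G S}"
    unfolding ds_domination_number_def
    using finite_ds_dominating[OF assms(1)] by (intro Min_in) auto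
  then show thesis using that by auto
qed

lemma ds_domination_number_ge_2:
  assumes "pair_graph G" and "card (pverts G) \<ge> 2"
  shows "ds_domination_number G \<ge> 2"
  using ds_domination_number_attained[OF assms] ds_dominating_card_ge_2[OF assms(1)] by metis

lemma ds_domination_number_eq_3_iff:
  assumes "pair_graph G" and "card (pverts G) \<ge> 2" and "ds_domination_number G \<noteq> 2"
  shows "ds_domination_number G = 3 \<longleftrightarrow> (\<exists>S. ds_dominating G S \<and> card S = 3)"
proof
  assume "ds_domination_number G = 3"
  then show "\<exists>S. ds_dominating G S \<and> card S = 3"
    using ds_domination_number_attained[OF assms(1,2)] by metis
next
  assume "\<exists>S. ds_dominating G S \<and> card S = 3"
  then have "ds_domination_number G \<le> 3"
    using ds_domination_number_le[OF assms(1)] by metis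
  then show "ds_domination_number G = 3"
    using ds_domination_number_ge_2[OF assms(1,2)] assms(3) by simp
qed

lemma ds_dominating_card_3_common_neighbour:
  assumes "ds_dominating G S" and "card S = 3"
  obtains x where "x \<in> S" and "\<And>v. v \<in> pverts G - S \<Longrightarrow> (v, x) \<in> parcs G"
proof -
  obtain R B where RB: "S = R \<union> B" "R \<union> B \<subseteq> pverts G" "R \<noteq> {}" "B \<noteq> {}" "R \<inter> B = {}"
    and dom: "\<forall>v \<in> pverts G - (R \<union> B).
      (\<exists>r\<in>R. (v, r) \<in> parcs G) \<and> (\<exists>b\<in>B. (v, b) \<in> parcs G)"
    using assms(1) unfolding ds_dominating_def by blast
  have "finite S" using assms(2) by (intro card_ge_0_finite) simp
  then have fin: "finite R" "finite B" using RB(1) by auto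
  then have "card R + card B = 3" "card R \<noteq> 0" "card B \<noteq> 0"
    using RB assms(2) by (auto simp: card_Un_disjoint)
  then have "card R = 1 \<or> card B = 1" by linarith
  then consider x where "R = {x}" | x where "B = {x}"
    by (auto simp: card_1_singleton_iff)
  then show thesis
  proof cases
    case (1 x)
    show thesis by (rule that[of x]) (use 1 RB dom in auto)
  next
    case (2 x)
    show thesis by (rule that[of x]) (use 2 RB dom in auto)
  qed
qed

section \<open>Vertices adjacent to all but at most one other vertex\<close>

lemma max_degree_ge_iff:
  assumes "pair_graph G" and "card (pverts G) \<ge> 2"
  shows "max_degree G \<ge> card (pverts G) - 2 \<longleftrightarrow>
    (\<exists>u\<in>pverts G. \<exists>w\<in>pverts G. u \<noteq> w \<and> (\<forall>v \<in> pverts G - {u, w}. (v, u) \<in> parcs G))"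
    (is "?L \<longleftrightarrow> ?R")
proof -
  interpret pair_graph G by fact
  define N where "N u = {v. (u, v) \<in> parcs G}" for u
  have deg: "out_degree (with_proj G) u = card (N u)" for u
  proof -
    have "out_arcs (with_proj G) u = Pair u ` N u"
      by (auto simp: out_arcs_def N_def)
    then show ?thesis
      by (simp add: out_degree_def card_image inj_on_def)
  qed
  have sub: "N u \<subseteq> pverts G - {u}" for u
    by (auto simp: N_def dest: wellformed' no_loops')
  have fin: "finite (N u)" for u
    using sub pair_finite_verts by (meson finite_Diff finite_subset)
  have mem: "v \<in> N u \<longleftrightarrow> (v, u) \<in> parcs G" for u v
    using arcs_symmetric by (auto simp: N_def)
  have ne: "pverts G \<noteq> {}" using assms(2) by auto
  have "?L \<longleftrightarrow> (\<exists>u\<in>pverts G. card (pverts G) - 2 \<le> card (N u))"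
    unfolding max_degree_def using ne pair_finite_verts
    by (subst Max_ge_iff) (auto simp: deg)
  also have "\<dots> \<longleftrightarrow> ?R"
  proof (rule bex_cong[OF refl])
    fix u assume u: "u \<in> pverts G"
    show "card (pverts G) - 2 \<le> card (N u) \<longleftrightarrow>
      (\<exists>w\<in>pverts G. u \<noteq> w \<and> (\<forall>v \<in> pverts G - {u, w}. (v, u) \<in> parcs G))"
    proof
      assume le: "card (pverts G) - 2 \<le> card (N u)"
      define M where "M = pverts G - {u} - N u"
      have "card M = card (pverts G) - 1 - card (N u)"
        unfolding M_def using sub fin u by (simp add: card_Diff_subset)
      then have "card M \<le> 1" using le by linarith
      moreover have "finite M" using pair_finite_verts by (simp add: M_def)
      ultimately have M1: "x = y" if "x \<in> M" "y \<in> M" for x y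
        using that by (auto simp: card_le_Suc0_iff_eq)
      have "card (pverts G - {u}) \<noteq> 0" using u assms(2) by simp
      then obtain w0 where w0: "w0 \<in> pverts G - {u}" by (metis card.empty ex_in_conv)
      \<comment> \<open>If \<open>u\<close> is adjacent to all other vertices, any of them can play the exceptional one.\<close>
      define w where "w = (if M = {} then w0 else (SOME x. x \<in> M))"
      have "w \<in> pverts G - {u}"
        using w0 some_in_eq[of M] by (auto simp: w_def M_def)
      moreover have "M \<subseteq> {w}"
        using M1 some_in_eq[of M] by (auto simp: w_def)
      ultimately show "\<exists>w\<in>pverts G. u \<noteq> w \<and> (\<forall>v \<in> pverts G - {u, w}. (v, u) \<in> parcs G)"
        by (intro bexI[of _ w]) (auto simp: M_def mem)
    next
      assume "\<exists>w\<in>pverts G. u \<noteq> w \<and> (\<forall>v \<in> pverts G - {u, w}. (v, u) \<in> parcs G)"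
      then obtain w where w: "w \<in> pverts G" "u \<noteq> w" "pverts G - {u, w} \<subseteq> N u"
        using mem by blast
      have "card (pverts G - {u, w}) = card (pverts G) - 2"
        using u w by (simp add: card_Diff_subset)
      then show "card (pverts G) - 2 \<le> card (N u)"
        using card_mono[OF fin w(3)] by simp
    qed
  qed
  finally show ?thesis .
qed

section \<open>Joins\<close>

lemma pverts_graph_join: "pverts (graph_join G H) = pverts G <+> pverts H"
  by (simp add: graph_join_def)

lemma parcs_graph_join_simps [simp]:
  "(Inl u, Inl v) \<in> parcs (graph_join G H) \<longleftrightarrow> (u, v) \<in> parcs G"
  "(Inr x, Inr y) \<in> parcs (graph_join G H) \<longleftrightarrow> (x, y) \<in> parcs H"
  "(Inl u, Inr y) \<in> parcs (graph_join G H) \<longleftrightarrow> u \<in> pverts G \<and> y \<in> pverts H"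
  "(Inr x, Inl v) \<in> parcs (graph_join G H) \<longleftrightarrow> x \<in> pverts H \<and> v \<in> pverts G"
  by (auto simp: graph_join_def)

lemma ds_dominating_join_Inl_iff:
  "ds_dominating (graph_join G H) (Inl ` S) \<longleftrightarrow> ds_dominating G S"
proof
  assume "ds_dominating (graph_join G H) (Inl ` S)"
  then obtain R B where sub: "Inl ` S \<subseteq> pverts (graph_join G H)"
    and RB: "R \<noteq> {}" "B \<noteq> {}" "R \<inter> B = {}" "R \<union> B = Inl ` S"
    and dom: "\<forall>v \<in> pverts (graph_join G H) - Inl ` S.
      (\<exists>r\<in>R. (v, r) \<in> parcs (graph_join G H)) \<and> (\<exists>b\<in>B. (v, b) \<in> parcs (graph_join G H))"
    unfolding ds_dominating_def by blast
  obtain R' where R': "R = Inl ` R'" using RB(4) by (metis Un_upper1 subset_imageE)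
  obtain B' where B': "B = Inl ` B'" using RB(4) by (metis Un_upper2 subset_imageE)
  have S: "S = R' \<union> B'"
    using RB(4) unfolding R' B' image_Un[symmetric] by (simp add: inj_image_eq_iff)
  have "ds_dominating G (R' \<union> B')"
  proof (rule ds_dominatingI)
    show "R' \<union> B' \<subseteq> pverts G" using sub by (auto simp: S pverts_graph_join)
    show "R' \<noteq> {}" "B' \<noteq> {}" "R' \<inter> B' = {}" using RB R' B' by auto
    fix v assume "v \<in> pverts G - (R' \<union> B')"
    then have "Inl v \<in> pverts (graph_join G H) - Inl ` S"
      by (auto simp: pverts_graph_join S)
    from bspec[OF dom this] show "\<exists>r\<in>R'. (v, r) \<in> parcs G" "\<exists>b\<in>B'. (v, b) \<in> parcs G"
      by (simp_all add: R' B')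
  qed
  then show "ds_dominating G S" by (simp add: S)
next
  assume "ds_dominating G S"
  then obtain R B where S: "S = R \<union> B" and sub: "R \<union> B \<subseteq> pverts G"
    and RB: "R \<noteq> {}" "B \<noteq> {}" "R \<inter> B = {}"
    and dom: "\<forall>v \<in> pverts G - (R \<union> B).
      (\<exists>r\<in>R. (v, r) \<in> parcs G) \<and> (\<exists>b\<in>B. (v, b) \<in> parcs G)"
    unfolding ds_dominating_def by blast
  have "ds_dominating (graph_join G H) (Inl ` R \<union> Inl ` B)"
  proof (rule ds_dominatingI)
    show "Inl ` R \<union> Inl ` B \<subseteq> pverts (graph_join G H)"
      using sub by (auto simp: pverts_graph_join)
    show "Inl ` R \<inter> Inl ` B = {}" using RB(3) by auto
    fix v assume "v \<in> pverts (graph_join G H) - (Inl ` R \<union> Inl ` B)"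
    then consider u where "v = Inl u" "u \<in> pverts G - (R \<union> B)" | y where "v = Inr y" "y \<in> pverts H"
      by (auto simp: pverts_graph_join)
    then have "(\<exists>r\<in>Inl ` R. (v, r) \<in> parcs (graph_join G H)) \<and>
      (\<exists>b\<in>Inl ` B. (v, b) \<in> parcs (graph_join G H))"
    proof cases
      case 1
      then show ?thesis using bspec[OF dom 1(2)] by simp
    next
      case 2
      then show ?thesis using RB sub by auto
    qed
    then show "\<exists>r\<in>Inl ` R. (v, r) \<in> parcs (graph_join G H)"
      "\<exists>b\<in>Inl ` B. (v, b) \<in> parcs (graph_join G H)" by blast+
  qed (use RB in simp_all)
  then show "ds_dominating (graph_join G H) (Inl ` S)" by (simp add: S image_Un)
qed

text \<open>
  The join is commutative up to the isomorphism \<open>case_sum Inr Inl\<close>; this is what makes statements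
  about the first summand sufficient.
\<close>

lemma ds_dominating_join_swap:
  assumes "ds_dominating (graph_join G H) S"
  shows "ds_dominating (graph_join H G) (case_sum Inr Inl ` S)"
proof -
  let ?f = "case_sum Inr Inl :: 'a + 'b \<Rightarrow> 'b + 'a"
  have inj: "inj ?f" by (auto simp: inj_def split: sum.splits)
  have verts: "pverts (graph_join H G) = ?f ` pverts (graph_join G H)"
    by (auto simp: pverts_graph_join Plus_def image_Un image_image)
  have arcs: "(?f x, ?f y) \<in> parcs (graph_join H G)"
    if "(x, y) \<in> parcs (graph_join G H)" for x y
    using that by (cases x; cases y) auto
  obtain R B where S: "S = R \<union> B" and sub: "R \<union> B \<subseteq> pverts (graph_join G H)"
    and RB: "R \<noteq> {}" "B \<noteq> {}" "R \<inter> B = {}"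
    and dom: "\<forall>v \<in> pverts (graph_join G H) - (R \<union> B).
      (\<exists>r\<in>R. (v, r) \<in> parcs (graph_join G H)) \<and> (\<exists>b\<in>B. (v, b) \<in> parcs (graph_join G H))"
    using assms unfolding ds_dominating_def by blast
  have "ds_dominating (graph_join H G) (?f ` R \<union> ?f ` B)"
  proof (rule ds_dominatingI)
    show "?f ` R \<union> ?f ` B \<subseteq> pverts (graph_join H G)" using sub verts by blast
    show "?f ` R \<inter> ?f ` B = {}" using RB(3) inj by (metis image_Int image_empty)
    fix v assume "v \<in> pverts (graph_join H G) - (?f ` R \<union> ?f ` B)"
    then obtain x where x: "v = ?f x" "x \<in> pverts (graph_join G H) - (R \<union> B)"
      using verts by blast
    show "\<exists>r\<in>?f ` R. (v, r) \<in> parcs (graph_join H G)"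
      unfolding x(1) using bspec[OF dom x(2)] by (blast intro: arcs)
    show "\<exists>b\<in>?f ` B. (v, b) \<in> parcs (graph_join H G)"
      unfolding x(1) using bspec[OF dom x(2)] by (blast intro: arcs)
  qed (use RB in simp_all)
  then show ?thesis by (simp add: S image_Un)
qed

lemma card_case_sum_swap_image: "card (case_sum Inr Inl ` S) = card S"
  by (rule card_image) (auto simp: inj_on_def split: sum.splits)

lemma ds_dominating_join_Inr:
  assumes "ds_dominating H S"
  shows "ds_dominating (graph_join G H) (Inr ` S)"
  using ds_dominating_join_swap[of H G "Inl ` S"] assms
  by (simp add: ds_dominating_join_Inl_iff image_image)

section \<open>DS-dominating sets of size three in a join\<close>

text \<open>
  The hypothesis that two vertices of \<open>S\<close> lie in \<open>G\<close> costs nothing: of the three vertices of \<open>S\<close>,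
  two lie on the same side of the join.
\<close>

lemma ds_dominating_join_card_3_cases:
  assumes GH: "pair_graph G" "pair_graph H"
    and card: "card (pverts G) \<ge> 2" "card (pverts H) \<ge> 2"
    and S: "ds_dominating (graph_join G H) S" "card S = 3" and two: "card (Inl -` S) \<ge> 2"
  shows "(\<exists>T. ds_dominating G T \<and> card T = 3) \<or>
    max_degree G \<ge> card (pverts G) - 2 \<or> max_degree H \<ge> card (pverts H) - 2"
proof -
  define A where "A = Inl -` S"
  define C where "C = Inr -` S"
  have SAC: "S = Inl ` A \<union> Inr ` C"
    unfolding A_def C_def by (auto simp: image_iff) (metis sum.exhaust)
  have "finite S" using S(2) by (intro card_ge_0_finite) simp
  then have fin: "finite A" "finite C"
    by (simp_all add: A_def C_def finite_vimageI)
  have "card S = card A + card C"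
    unfolding SAC using fin by (subst card_Un_disjoint) (auto simp: card_image)
  then have "card C = 0 \<or> card C = 1 \<and> card A = 2"
    using two S(2) unfolding A_def by linarith
  then show ?thesis
  proof
    assume "card C = 0"
    then have "S = Inl ` A" using SAC fin by simp
    then have "ds_dominating G A" "card A = 3"
      using S by (auto simp: ds_dominating_join_Inl_iff card_image)
    then show ?thesis by blast
  next
    assume "card C = 1 \<and> card A = 2"
    then obtain h a b where C: "C = {h}" and A: "A = {a, b}" "a \<noteq> b"
      by (auto simp: card_1_singleton_iff card_2_iff)
    have Sabh: "S = {Inl a, Inl b, Inr h}" using SAC A C by auto
    have "S \<subseteq> pverts (graph_join G H)" using S(1) by (simp add: ds_dominating_def)
    then have abh: "a \<in> pverts G" "b \<in> pverts G" "h \<in> pverts H"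
      by (auto simp: Sabh pverts_graph_join)
    obtain x where x: "x \<in> S"
      and adj: "\<And>v. v \<in> pverts (graph_join G H) - S \<Longrightarrow> (v, x) \<in> parcs (graph_join G H)"
      using ds_dominating_card_3_common_neighbour[OF S] by blast
    have adjG: "(Inl v, x) \<in> parcs (graph_join G H)" if "v \<in> pverts G - {a, b}" for v
      using that by (intro adj) (auto simp: pverts_graph_join Sabh)
    have adjH: "(Inr v, x) \<in> parcs (graph_join G H)" if "v \<in> pverts H - {h}" for v
      using that by (intro adj) (auto simp: pverts_graph_join Sabh)
    consider "x = Inl a" | "x = Inl b" | "x = Inr h" using x Sabh by auto
    then show ?thesis
    proof cases
      case 1
      then have "\<forall>v \<in> pverts G - {a, b}. (v, a) \<in> parcs G" using adjG by auto
      then show ?thesis using abh A(2) max_degree_ge_iff[OF GH(1) card(1)] by blast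
    next
      case 2
      then have "\<forall>v \<in> pverts G - {b, a}. (v, b) \<in> parcs G" using adjG by auto
      then show ?thesis using abh A(2)[symmetric] max_degree_ge_iff[OF GH(1) card(1)] by blast
    next
      case 3
      have "card (pverts H - {h}) \<noteq> 0" using abh(3) card(2) by simp
      then obtain w where w: "w \<in> pverts H" "h \<noteq> w"
        by (metis card.empty ex_in_conv DiffE insertI1)
      have "\<forall>v \<in> pverts H - {h, w}. (v, h) \<in> parcs H" using 3 adjH by auto
      then show ?thesis using abh w max_degree_ge_iff[OF GH(2) card(2)] by blast
    qed
  qed
qed

lemma ds_dominating_join_card_3_if_max_degree:
  assumes "pair_graph G" and "card (pverts G) \<ge> 2" and "pverts H \<noteq> {}"
    and "max_degree G \<ge> card (pverts G) - 2"
  shows "\<exists>S. ds_dominating (graph_join G H) S \<and> card S = 3"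
proof -
  obtain u w where uw: "u \<in> pverts G" "w \<in> pverts G" "u \<noteq> w"
    and adj: "\<forall>v \<in> pverts G - {u, w}. (v, u) \<in> parcs G"
    using assms(4) max_degree_ge_iff[OF assms(1,2)] by blast
  obtain h where h: "h \<in> pverts H" using assms(3) by blast
  have "ds_dominating (graph_join G H) ({Inl u} \<union> {Inl w, Inr h})"
    by (rule ds_dominatingI) (use uw h adj in \<open>auto simp: pverts_graph_join\<close>)
  moreover have "card ({Inl u} \<union> {Inl w, Inr h}) = 3" using uw(3) by simp
  ultimately show ?thesis by blast
qed

theorem theorem3p2:
  fixes G :: "'a pair_pre_digraph" and H :: "'b pair_pre_digraph" and m n :: nat
  assumes "pair_graph G" and "pair_graph H"
    and "card (pverts G) = m" and "card (pverts H) = n"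
    and "m \<ge> 2" and "n \<ge> 2"
    and "ds_domination_number (graph_join G H) \<noteq> 2"
  shows "ds_domination_number (graph_join G H) = 3 \<longleftrightarrow>
    (ds_domination_number G = 3 \<or> ds_domination_number H = 3) \<or>
    (max_degree G \<ge> m - 2 \<or> max_degree H \<ge> n - 2)"
proof -
  have cG: "card (pverts G) \<ge> 2" and cH: "card (pverts H) \<ge> 2"
    using assms by simp_all
  have ne: "pverts G \<noteq> {}" "pverts H \<noteq> {}" using cG cH by auto
  have J: "pair_graph (graph_join G H)"
    using assms(1,2) by (rule pair_graph_graph_join)
  have cJ: "card (pverts (graph_join G H)) \<ge> 2"
  proof -
    have "finite (pverts G)" "finite (pverts H)"
      using cG cH by (auto intro: card_ge_0_finite)
    then show ?thesis using cG by (simp add: pverts_graph_join card_Plus)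
  qed
  have J_card_ne_2: "card S \<noteq> 2" if "ds_dominating (graph_join G H) S" for S
    using ds_domination_number_le[OF J that] ds_domination_number_ge_2[OF J cJ] assms(7) by simp
  have G2: "ds_domination_number G \<noteq> 2"
  proof
    assume "ds_domination_number G = 2"
    then obtain S where "ds_dominating G S" "card S = 2"
      using ds_domination_number_attained[OF assms(1) cG] by metis
    then show False
      using J_card_ne_2[of "Inl ` S"] by (simp add: ds_dominating_join_Inl_iff card_image)
  qed
  have H2: "ds_domination_number H \<noteq> 2"
  proof
    assume "ds_domination_number H = 2"
    then obtain S where "ds_dominating H S" "card S = 2"
      using ds_domination_number_attained[OF assms(2) cH] by metis
    then show False
      using J_card_ne_2[of "Inr ` S"] by (simp add: ds_dominating_join_Inr card_image)
  qed
  note iffG = ds_domination_number_eq_3_iff[OF assms(1) cG G2]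
  note iffH = ds_domination_number_eq_3_iff[OF assms(2) cH H2]
  note iffJ = ds_domination_number_eq_3_iff[OF J cJ assms(7)]
  show ?thesis
  proof
    assume "ds_domination_number (graph_join G H) = 3"
    then obtain S where S: "ds_dominating (graph_join G H) S" "card S = 3"
      using iffJ by blast
    define S' where "S' = (case_sum Inr Inl ` S :: ('b + 'a) set)"
    have S': "ds_dominating (graph_join H G) S'" "card S' = 3"
      using S by (simp_all add: S'_def ds_dominating_join_swap card_case_sum_swap_image)
    have vim: "Inl -` S' = Inr -` S"
      by (force simp: S'_def image_iff split: sum.splits)
    have "S = Inl ` (Inl -` S) \<union> Inr ` (Inr -` S)"
      by (auto simp: image_iff) (metis sum.exhaust)
    then have "card S = card (Inl ` (Inl -` S) \<union> Inr ` (Inr -` S))"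
      by (rule arg_cong)
    also have "\<dots> \<le> card (Inl -` S) + card (Inr -` S)"
      by (rule order_trans[OF card_Un_le]) (simp add: card_image del: image_vimage_eq)
    finally have "card (Inl -` S) \<ge> 2 \<or> card (Inl -` S') \<ge> 2"
      unfolding vim using S(2) by linarith
    then show "(ds_domination_number G = 3 \<or> ds_domination_number H = 3) \<or>
      (max_degree G \<ge> m - 2 \<or> max_degree H \<ge> n - 2)"
      using ds_dominating_join_card_3_cases[OF assms(1,2) cG cH S]
        ds_dominating_join_card_3_cases[OF assms(2,1) cH cG S'] iffG iffH assms(3,4)
      by blast
  next
    assume "(ds_domination_number G = 3 \<or> ds_domination_number H = 3) \<or>
      (max_degree G \<ge> m - 2 \<or> max_degree H \<ge> n - 2)"
    then consider "ds_domination_number G = 3" | "ds_domination_number H = 3"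
      | "max_degree G \<ge> m - 2" | "max_degree H \<ge> n - 2" by blast
    then have "\<exists>S. ds_dominating (graph_join G H) S \<and> card S = 3"
    proof cases
      case 1
      then obtain S where "ds_dominating G S" "card S = 3" using iffG by blast
      then show ?thesis
        by (intro exI[of _ "Inl ` S"]) (simp add: ds_dominating_join_Inl_iff card_image)
    next
      case 2
      then obtain S where "ds_dominating H S" "card S = 3" using iffH by blast
      then show ?thesis
        by (intro exI[of _ "Inr ` S"]) (simp add: ds_dominating_join_Inr card_image)
    next
      case 3
      then show ?thesis
        using ds_dominating_join_card_3_if_max_degree[OF assms(1) cG ne(2)] assms(3) by simp
    next
      case 4
      then obtain S where "ds_dominating (graph_join H G) S" "card S = 3"
        using ds_dominating_join_card_3_if_max_degree[OF assms(2) cH ne(1)] assms(4) by auto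
      then show ?thesis
        using ds_dominating_join_swap card_case_sum_swap_image by metis
    qed
    then show "ds_domination_number (graph_join G H) = 3" using iffJ by blast
  qed
qed

end
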